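(* Let $B$ be a Poisson Hopf algebra over $k$, with comultiplication $\Delta$, counit $\epsilon$ and antipode $S$, and let $B[x;\alpha,\delta]_p$ be a Poisson polynomial algebra over $B$ which is a Poisson Hopf algebra containing $B$ as a Poisson Hopf subalgebra. Suppose that $\epsilon(x)=0$ and $\Delta(x)=g\otimes x+x\otimes 1+w$ for some $w=\sum w_1\otimes w_2\in B^+\otimes B^+$ and some group-like element $g\in B$. Then: (1) There exists a linear map $\eta:B\to k$ such that $$\alpha(b)=\eta(b_1)b_2=b_1\eta(b_2)+\{g,b\}g^{-1}\quad\text{for all } b\in B,$$ and $\eta$ satisfies $$\eta(ab)=\epsilon(a)\eta(b)+\epsilon(b)\eta(a)\quad\text{and}\quad \eta(\{a,b\})=0\quad\text{for all } a,b\in B.$$ (2) For all $b\in B$, $$\Delta\delta(b)-\delta(b_1)\otimes b_2-gb_1\otimes\delta(b_2)=\{w,\Delta(b)\}-\Delta(\alpha(b))\,w .$$ (3) The element $w$ satisfies $$\sum S(w_1)w_2=\sum g^{-1}w_1S(w_2)\quad\text{and}\quad w\otimes 1+(\Delta\otimes \mathrm{Id})(w)=g\otimes w+(\mathrm{Id}\otimes\Delta)(w).$$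
   Context: $k$ is a field; algebras, coalgebras and tensor products are over $k$. Sweedler notation $\Delta(b)=b_1\otimes b_2$ is used with the summation sign omitted. A Poisson algebra is a commutative $k$-algebra $A$ with a Lie bracket $\{\cdot,\cdot\}$ such that $\{a,bc\}=\{a,b\}c+b\{a,c\}$. For a Poisson algebra $A$, $A\otimes A$ is a Poisson algebra with $\{a\otimes b,c\otimes d\}=ac\otimes\{b,d\}+\{a,c\}\otimes bd$. A Poisson Hopf algebra is a commutative Hopf algebra $B$ with a Poisson bracket such that $\Delta(\{a,b\})=\{\Delta(a),\Delta(b)\}$ for all $a,b\in B$. $B^+=\ker\epsilon$. Poisson polynomial algebra (Poisson Ore extension): let $\alpha$ be a Poisson derivation of $A$ (a $k$-linear map which is a derivation for both the multiplication and the bracket), and let $\delta$ be a derivation of the algebra $A$ such that $\delta(\{a,b\})=\{\delta(a),b\}+\{a,\delta(b)\}+\alpha(a)\delta(b)-\delta(a)\alpha(b)$ for all $a,b\in A$. Then the bracket of $A$ extends uniquely to a Poisson bracket on the polynomial ring $A[x]$ with $\{x,b\}=\alpha(b)x+\delta(b)$ for $b\in A$; this Poisson algebra is denoted $A[x;\alpha,\delta]_p$. *)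

theory Defs
  imports "HOL-Computational_Algebra.Polynomial" "HOL-Library.Poly_Mapping"
begin

text \<open>
  A \<open>k\<close>-algebra is a type of class \<^class>\<open>comm_ring_1\<close> together with an explicit scalar
  multiplication \<open>s\<close> over a field type, so that several algebras over one
  arbitrary field can be considered at the same time.

  For a vector space \<open>A\<close> the tensor product \<open>A \<otimes> A\<close> is the usual quotient of the free vector
  space on \<open>A \<times> A\<close> by the span of the bilinearity relations.  Since that span depends on the
  scalar multiplication, which is a term, the quotient is a set of cosets and not a type.
  The threefold tensor product \<open>A \<otimes> A \<otimes> A\<close> is the corresponding quotient of the free vector
  space on \<open>A \<times> A \<times> A\<close>, which identifies \<open>(A \<otimes> A) \<otimes> A\<close> with \<open>A \<otimes> (A \<otimes> A)\<close>.
\<close>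

type_synonym ('x, 'k) free = "'x \<Rightarrow>\<^sub>0 'k"
type_synonym ('a, 'k) tensor2 = "('a \<times> 'a, 'k) free set"
type_synonym ('a, 'k) tensor3 = "('a \<times> 'a \<times> 'a, 'k) free set"

definition gen :: "'x \<Rightarrow> ('x, 'k::field) free"
  where "gen i = Poly_Mapping.single i 1"

definition fscale :: "'k::field \<Rightarrow> ('x, 'k) free \<Rightarrow> ('x, 'k) free"
  where "fscale c = Poly_Mapping.map (\<lambda>u. c * u)"

definition lin_ext :: "('k::field \<Rightarrow> 'v \<Rightarrow> 'v::ab_group_add) \<Rightarrow> ('x \<Rightarrow> 'v) \<Rightarrow> ('x, 'k) free \<Rightarrow> 'v"
  where "lin_ext s f r = (\<Sum>i\<in>Poly_Mapping.keys r. s (Poly_Mapping.lookup r i) (f i))"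

definition bilin_ext ::
    "('k::field \<Rightarrow> 'v \<Rightarrow> 'v::ab_group_add) \<Rightarrow> ('x \<Rightarrow> 'y \<Rightarrow> 'v) \<Rightarrow> ('x, 'k) free \<Rightarrow> ('y, 'k) free \<Rightarrow> 'v"
  where "bilin_ext s f r r' = lin_ext s (\<lambda>i. lin_ext s (f i) r') r"

definition null2 :: "('k::field \<Rightarrow> 'a \<Rightarrow> 'a::ab_group_add) \<Rightarrow> ('a \<times> 'a, 'k) free set"
  where "null2 s = module.span fscale
    ({gen (a + a', b) - gen (a, b) - gen (a', b) | a a' b. True}
     \<union> {gen (a, b + b') - gen (a, b) - gen (a, b') | a b b'. True}
     \<union> {gen (s c a, b) - fscale c (gen (a, b)) | c a b. True}
     \<union> {gen (a, s c b) - fscale c (gen (a, b)) | c a b. True})"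

definition null3 :: "('k::field \<Rightarrow> 'a \<Rightarrow> 'a::ab_group_add) \<Rightarrow> ('a \<times> 'a \<times> 'a, 'k) free set"
  where "null3 s = module.span fscale
    ({gen (a + a', b, d) - gen (a, b, d) - gen (a', b, d) | a a' b d. True}
     \<union> {gen (a, b + b', d) - gen (a, b, d) - gen (a, b', d) | a b b' d. True}
     \<union> {gen (a, b, d + d') - gen (a, b, d) - gen (a, b, d') | a b d d'. True}
     \<union> {gen (s c a, b, d) - fscale c (gen (a, b, d)) | c a b d. True}
     \<union> {gen (a, s c b, d) - fscale c (gen (a, b, d)) | c a b d. True}
     \<union> {gen (a, b, s c d) - fscale c (gen (a, b, d)) | c a b d. True})"

definition cls2 :: "('k::field \<Rightarrow> 'a \<Rightarrow> 'a::ab_group_add) \<Rightarrow> ('a \<times> 'a, 'k) free \<Rightarrow> ('a, 'k) tensor2"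
  where "cls2 s r = {q. q - r \<in> null2 s}"

definition cls3 ::
    "('k::field \<Rightarrow> 'a \<Rightarrow> 'a::ab_group_add) \<Rightarrow> ('a \<times> 'a \<times> 'a, 'k) free \<Rightarrow> ('a, 'k) tensor3"
  where "cls3 s r = {q. q - r \<in> null3 s}"

text \<open>
  The operations below are computed on an arbitrary representative.  They are independent
  of its choice whenever the maps involved are linear (bilinear for \<open>tlift\<close> and the bracket).
\<close>

definition rep :: "'r set \<Rightarrow> 'r"
  where "rep t = (SOME r. r \<in> t)"

definition tensor_space :: "('k::field \<Rightarrow> 'a \<Rightarrow> 'a::ab_group_add) \<Rightarrow> ('a, 'k) tensor2 set"
  where "tensor_space s = range (cls2 s)"

definition pure2 ::
    "('k::field \<Rightarrow> 'a \<Rightarrow> 'a::ab_group_add) \<Rightarrow> 'a \<Rightarrow> 'a \<Rightarrow> ('a, 'k) tensor2"  (infixl \<open>\<otimes>\<index>\<close> 75)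
  where "a \<otimes>\<^bsub>s\<^esub> b = cls2 s (gen (a, b))"

text \<open>Cosets are added and subtracted elementwise, so these serve both two- and threefold tensors.\<close>

definition tplus :: "'r::ab_group_add set \<Rightarrow> 'r set \<Rightarrow> 'r set"  (infixl \<open>\<oplus>\<close> 65)
  where "t \<oplus> u = {p + q | p q. p \<in> t \<and> q \<in> u}"

definition tminus :: "'r::ab_group_add set \<Rightarrow> 'r set \<Rightarrow> 'r set"  (infixl \<open>\<ominus>\<close> 65)
  where "t \<ominus> u = {p - q | p q. p \<in> t \<and> q \<in> u}"

definition tscale ::
    "('k::field \<Rightarrow> 'a \<Rightarrow> 'a::ab_group_add) \<Rightarrow> 'k \<Rightarrow> ('a, 'k) tensor2 \<Rightarrow> ('a, 'k) tensor2"
  where "tscale s c t = cls2 s (fscale c (rep t))"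

definition tmult ::
    "('k::field \<Rightarrow> 'a \<Rightarrow> 'a::comm_ring_1) \<Rightarrow> ('a, 'k) tensor2 \<Rightarrow> ('a, 'k) tensor2 \<Rightarrow> ('a, 'k) tensor2"
    (infixl \<open>\<odot>\<index>\<close> 70)
  where "t \<odot>\<^bsub>s\<^esub> u =
    cls2 s (bilin_ext fscale (\<lambda>(a, b) (c, d). gen (a * c, b * d)) (rep t) (rep u))"

definition tbracket ::
    "('k::field \<Rightarrow> 'a \<Rightarrow> 'a::comm_ring_1) \<Rightarrow> ('a \<Rightarrow> 'a \<Rightarrow> 'a)
      \<Rightarrow> ('a, 'k) tensor2 \<Rightarrow> ('a, 'k) tensor2 \<Rightarrow> ('a, 'k) tensor2"
  where "tbracket s br t u =
    cls2 s (bilin_ext fscale (\<lambda>(a, b) (c, d). gen (a * c, br b d) + gen (br a c, b * d)) (rep t) (rep u))"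

text \<open>\<open>tmap s' f g\<close> is \<open>f \<otimes> g\<close>, where \<open>s'\<close> is the scalar multiplication of the target;
  \<open>tlift s' f\<close> is the linear map \<open>a \<otimes> b \<mapsto> f a b\<close> induced by a bilinear map \<open>f\<close>.\<close>

definition tmap ::
    "('k::field \<Rightarrow> 'b \<Rightarrow> 'b::ab_group_add) \<Rightarrow> ('a \<Rightarrow> 'b) \<Rightarrow> ('a \<Rightarrow> 'b) \<Rightarrow> ('a, 'k) tensor2 \<Rightarrow> ('b, 'k) tensor2"
  where "tmap s' f g t = cls2 s' (lin_ext fscale (\<lambda>(a, b). gen (f a, g b)) (rep t))"

definition tlift ::
    "('k::field \<Rightarrow> 'v \<Rightarrow> 'v::ab_group_add) \<Rightarrow> ('a \<Rightarrow> 'a \<Rightarrow> 'v) \<Rightarrow> ('a, 'k) tensor2 \<Rightarrow> 'v"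
  where "tlift s' f t = lin_ext s' (\<lambda>(a, b). f a b) (rep t)"

definition tensor_elt ::
    "('k::field \<Rightarrow> 'a \<Rightarrow> 'a::ab_group_add) \<Rightarrow> ('a, 'k) tensor2 \<Rightarrow> 'a \<Rightarrow> ('a, 'k) tensor3"
  where "tensor_elt s t b = cls3 s (lin_ext fscale (\<lambda>(a1, a2). gen (a1, a2, b)) (rep t))"

definition elt_tensor ::
    "('k::field \<Rightarrow> 'a \<Rightarrow> 'a::ab_group_add) \<Rightarrow> 'a \<Rightarrow> ('a, 'k) tensor2 \<Rightarrow> ('a, 'k) tensor3"
  where "elt_tensor s a t = cls3 s (lin_ext fscale (\<lambda>(b1, b2). gen (a, b1, b2)) (rep t))"

text \<open>\<open>\<Delta> \<otimes> Id\<close> and \<open>Id \<otimes> \<Delta>\<close>.\<close>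

definition comult_left ::
    "('k::field \<Rightarrow> 'a \<Rightarrow> 'a::ab_group_add) \<Rightarrow> ('a \<Rightarrow> ('a, 'k) tensor2) \<Rightarrow> ('a, 'k) tensor2 \<Rightarrow> ('a, 'k) tensor3"
  where "comult_left s \<Delta> t =
    cls3 s (lin_ext fscale (\<lambda>(a, b). rep (tensor_elt s (\<Delta> a) b)) (rep t))"

definition comult_right ::
    "('k::field \<Rightarrow> 'a \<Rightarrow> 'a::ab_group_add) \<Rightarrow> ('a \<Rightarrow> ('a, 'k) tensor2) \<Rightarrow> ('a, 'k) tensor2 \<Rightarrow> ('a, 'k) tensor3"
  where "comult_right s \<Delta> t =
    cls3 s (lin_ext fscale (\<lambda>(a, b). rep (elt_tensor s a (\<Delta> b))) (rep t))"

locale k_algebra = vector_space scale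
  for scale :: "'k::field \<Rightarrow> 'a::comm_ring_1 \<Rightarrow> 'a" +
  assumes scale_mult_left: "scale c (a * b) = scale c a * b"

locale poisson_algebra = k_algebra scale
  for scale :: "'k::field \<Rightarrow> 'a::comm_ring_1 \<Rightarrow> 'a" +
  fixes br :: "'a \<Rightarrow> 'a \<Rightarrow> 'a"
  assumes br_linear_left: "Vector_Spaces.linear scale scale (\<lambda>a. br a b)"
    and br_linear_right: "Vector_Spaces.linear scale scale (br a)"
    and br_alternating: "br a a = 0"
    and br_jacobi: "br a (br b c) + br b (br c a) + br c (br a b) = 0"
    and br_leibniz: "br a (b * c) = br a b * c + b * br a c"

text \<open>Commutativity and \<open>1 \<noteq> 0\<close> come from the type class; the latter is no restriction since \<open>\<epsilon> 1 = 1\<close>.\<close>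

locale hopf_algebra = k_algebra scale
  for scale :: "'k::field \<Rightarrow> 'a::comm_ring_1 \<Rightarrow> 'a" +
  fixes \<Delta> :: "'a \<Rightarrow> ('a, 'k) tensor2"
    and \<epsilon> :: "'a \<Rightarrow> 'k"
    and S :: "'a \<Rightarrow> 'a"
  assumes comult_in: "\<Delta> a \<in> tensor_space scale"
    and comult_add: "\<Delta> (a + b) = \<Delta> a \<oplus> \<Delta> b"
    and comult_scale: "\<Delta> (scale c a) = tscale scale c (\<Delta> a)"
    and comult_one: "\<Delta> 1 = 1 \<otimes>\<^bsub>scale\<^esub> 1"
    and comult_mult: "\<Delta> (a * b) = \<Delta> a \<odot>\<^bsub>scale\<^esub> \<Delta> b"
    and coassoc: "comult_left scale \<Delta> (\<Delta> a) = comult_right scale \<Delta> (\<Delta> a)"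
    and counit_linear: "Vector_Spaces.linear scale (*) \<epsilon>"
    and counit_one: "\<epsilon> 1 = 1"
    and counit_mult: "\<epsilon> (a * b) = \<epsilon> a * \<epsilon> b"
    and counit_left: "tlift scale (\<lambda>a b. scale (\<epsilon> a) b) (\<Delta> a) = a"
    and counit_right: "tlift scale (\<lambda>a b. scale (\<epsilon> b) a) (\<Delta> a) = a"
    and antipode_linear: "Vector_Spaces.linear scale scale S"
    and antipode_left: "tlift scale (\<lambda>a b. S a * b) (\<Delta> a) = scale (\<epsilon> a) 1"
    and antipode_right: "tlift scale (\<lambda>a b. a * S b) (\<Delta> a) = scale (\<epsilon> a) 1"

locale poisson_hopf_algebra = hopf_algebra scale \<Delta> \<epsilon> S + poisson_algebra scale br
  for scale :: "'k::field \<Rightarrow> 'a::comm_ring_1 \<Rightarrow> 'a" and \<Delta> \<epsilon> S br +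
  assumes comult_br: "\<Delta> (br a b) = tbracket scale br (\<Delta> a) (\<Delta> b)"

definition group_like ::
    "('k::field \<Rightarrow> 'a \<Rightarrow> 'a::comm_ring_1) \<Rightarrow> ('a \<Rightarrow> ('a, 'k) tensor2) \<Rightarrow> ('a \<Rightarrow> 'k) \<Rightarrow> 'a \<Rightarrow> bool"
  where "group_like s \<Delta> \<epsilon> g \<longleftrightarrow> \<Delta> g = g \<otimes>\<^bsub>s\<^esub> g \<and> \<epsilon> g = 1"

text \<open>\<open>B\<^sup>+ \<otimes> B\<^sup>+\<close> as a subspace of \<open>B \<otimes> B\<close>.\<close>

definition augmentation_tensors ::
    "('k::field \<Rightarrow> 'a \<Rightarrow> 'a::comm_ring_1) \<Rightarrow> ('a \<Rightarrow> 'k) \<Rightarrow> ('a, 'k) tensor2 set"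
  where "augmentation_tensors s \<epsilon> =
    cls2 s ` {r. Poly_Mapping.keys r \<subseteq> {a. \<epsilon> a = 0} \<times> {a. \<epsilon> a = 0}}"

text \<open>Only used for units, where it is the inverse in the ring; group-like elements are units.\<close>

definition unit_inverse :: "'a::comm_ring_1 \<Rightarrow> 'a"
  where "unit_inverse g = (THE h. g * h = 1)"

definition algebra_derivation ::
    "('k::field \<Rightarrow> 'a \<Rightarrow> 'a::comm_ring_1) \<Rightarrow> ('a \<Rightarrow> 'a) \<Rightarrow> bool"
  where "algebra_derivation s D \<longleftrightarrow>
    Vector_Spaces.linear s s D \<and> (\<forall>a b. D (a * b) = D a * b + a * D b)"

definition poisson_derivation ::
    "('k::field \<Rightarrow> 'a \<Rightarrow> 'a::comm_ring_1) \<Rightarrow> ('a \<Rightarrow> 'a \<Rightarrow> 'a) \<Rightarrow> ('a \<Rightarrow> 'a) \<Rightarrow> bool"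
  where "poisson_derivation s br D \<longleftrightarrow>
    algebra_derivation s D \<and> (\<forall>a b. D (br a b) = br (D a) b + br a (D b))"

definition poly_scale :: "('k::field \<Rightarrow> 'a \<Rightarrow> 'a::comm_ring_1) \<Rightarrow> 'k \<Rightarrow> 'a poly \<Rightarrow> 'a poly"
  where "poly_scale s c p = smult (s c 1) p"

text \<open>\<open>brP\<close> is the Poisson bracket of \<open>A[x; \<alpha>, \<delta>]\<^sub>p\<close>: the data \<open>\<alpha>, \<delta>\<close> are admissible, and \<open>brP\<close> is
  the (unique) Poisson bracket on \<open>A[x]\<close> which extends \<open>br\<close> and satisfies \<open>{x, b} = \<alpha>(b) x + \<delta>(b)\<close>.\<close>

definition poisson_polynomial_algebra ::
    "('k::field \<Rightarrow> 'a \<Rightarrow> 'a::comm_ring_1) \<Rightarrow> ('a \<Rightarrow> 'a \<Rightarrow> 'a) \<Rightarrow> ('a \<Rightarrow> 'a) \<Rightarrow> ('a \<Rightarrow> 'a)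
      \<Rightarrow> ('a poly \<Rightarrow> 'a poly \<Rightarrow> 'a poly) \<Rightarrow> bool"
  where "poisson_polynomial_algebra s br \<alpha> \<delta> brP \<longleftrightarrow>
    poisson_algebra s br \<and>
    poisson_derivation s br \<alpha> \<and>
    algebra_derivation s \<delta> \<and>
    (\<forall>a b. \<delta> (br a b) = br (\<delta> a) b + br a (\<delta> b) + \<alpha> a * \<delta> b - \<delta> a * \<alpha> b) \<and>
    poisson_algebra (poly_scale s) brP \<and>
    (\<forall>a b. brP [:a:] [:b:] = [:br a b:]) \<and>
    (\<forall>b. brP [:0, 1:] [:b:] = [:\<alpha> b:] * [:0, 1:] + [:\<delta> b:])"

text \<open>The inclusion \<open>b \<mapsto> [:b:]\<close> of \<open>A\<close> in \<open>A[x]\<close> is a morphism of Poisson Hopf algebras.\<close>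

definition poisson_hopf_subalgebra_poly ::
    "('k::field \<Rightarrow> 'a \<Rightarrow> 'a::comm_ring_1) \<Rightarrow> ('a \<Rightarrow> ('a, 'k) tensor2) \<Rightarrow> ('a \<Rightarrow> 'k) \<Rightarrow> ('a \<Rightarrow> 'a)
      \<Rightarrow> ('a \<Rightarrow> 'a \<Rightarrow> 'a) \<Rightarrow> ('a poly \<Rightarrow> ('a poly, 'k) tensor2) \<Rightarrow> ('a poly \<Rightarrow> 'k)
      \<Rightarrow> ('a poly \<Rightarrow> 'a poly) \<Rightarrow> ('a poly \<Rightarrow> 'a poly \<Rightarrow> 'a poly) \<Rightarrow> bool"
  where "poisson_hopf_subalgebra_poly s \<Delta> \<epsilon> S br \<Delta>P \<epsilon>P SP brP \<longleftrightarrow>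
    (\<forall>b. \<Delta>P [:b:] = tmap (poly_scale s) (\<lambda>a. [:a:]) (\<lambda>a. [:a:]) (\<Delta> b)) \<and>
    (\<forall>b. \<epsilon>P [:b:] = \<epsilon> b) \<and>
    (\<forall>b. SP [:b:] = [:S b:]) \<and>
    (\<forall>a b. brP [:a:] [:b:] = [:br a b:])"

end

theory Submission
  imports Defs
begin

text \<open>
  Apply \<open>\<Delta>\<close> to \<open>{x, b} = \<alpha>(b) x + \<delta>(b)\<close> and expand both sides of \<open>\<Delta>{x, b} = {\<Delta>(x), \<Delta>(b)}\<close>.  Comparing
  the coefficients of \<open>x \<otimes> 1\<close> and \<open>1 \<otimes> x\<close> gives \<open>\<Delta>(\<alpha>(b)) = \<alpha>(b\<^sub>1) \<otimes> b\<^sub>2\<close> and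
  \<open>\<Delta>(\<alpha>(b)) (g \<otimes> 1) = g b\<^sub>1 \<otimes> \<alpha>(b\<^sub>2) + {g, b\<^sub>1} \<otimes> b\<^sub>2\<close>; applying \<open>\<epsilon> \<otimes> Id\<close> and \<open>Id \<otimes> \<epsilon>\<close> yields (1) with
  \<open>\<eta> = \<epsilon> \<circ> \<alpha>\<close>, which kills brackets because \<open>\<epsilon>({a, b}) = 2 \<epsilon>({a, b})\<close>.  The constant coefficient is (2).
  Part (3) is the constant coefficient of coassociativity and of the two antipode axioms at \<open>x\<close>.
  Identities between tensors are checked by evaluating all bilinear (trilinear) forms on them, since
  linear forms on the free space that vanish on the relations separate the cosets.
\<close>

subsection \<open>Free vector spaces\<close>

lemma lookup_fscale [simp]: "Poly_Mapping.lookup (fscale c r) i = c * Poly_Mapping.lookup r i"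
  unfolding fscale_def by transfer (simp add: when_def)

lemma vector_space_fscale: "vector_space fscale"
  by unfold_locales (auto intro!: poly_mapping_eqI simp: lookup_add algebra_simps)

lemma vector_space_mult: "vector_space ((*) :: 'k::field \<Rightarrow> 'k \<Rightarrow> 'k)"
  by unfold_locales (auto simp: algebra_simps)

lemma linear_lin_ext:
  assumes "vector_space V"
  shows "Vector_Spaces.linear fscale V (lin_ext V f)"
proof -
  interpret vector_space V by fact
  interpret F: vector_space fscale by (rule vector_space_fscale)
  \<comment> \<open>Keys outside the support contribute zero, so sums for different arguments can be
    taken over one common finite index set.\<close>
  have expand: "lin_ext V f r = (\<Sum>i\<in>K. V (Poly_Mapping.lookup r i) (f i))"
    if "finite K" "Poly_Mapping.keys r \<subseteq> K" for r K
    unfolding lin_ext_def using that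
    by (intro sum.mono_neutral_left) (auto simp: in_keys_iff)
  show ?thesis
  proof (unfold_locales, goal_cases)
    case (1 r r')
    let ?K = "Poly_Mapping.keys r \<union> Poly_Mapping.keys r'"
    show ?case
      using expand[of ?K r] expand[of ?K r'] expand[of ?K "r + r'"] Poly_Mapping.keys_add[of r r']
      by (simp add: lookup_add scale_left_distrib sum.distrib)
  next
    case (2 c r)
    have "Poly_Mapping.keys (fscale c r) \<subseteq> Poly_Mapping.keys r"
      by (auto simp: in_keys_iff)
    then show ?case
      using expand[of "Poly_Mapping.keys r" r] expand[of "Poly_Mapping.keys r" "fscale c r"]
      by (simp add: scale_sum_right)
  qed
qed

lemma lin_ext_gen:
  assumes "vector_space V"
  shows "lin_ext V f (gen i) = f i"
  using assms by (simp add: lin_ext_def gen_def vector_space.vector_space_assms(4))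

lemma linear_of_lin_ext:
  assumes "Vector_Spaces.linear V W L"
  shows "L (lin_ext V f r) = lin_ext W (\<lambda>i. L (f i)) r"
proof -
  interpret Vector_Spaces.linear V W L by fact
  show ?thesis by (simp add: lin_ext_def sum scale)
qed

lemma lin_ext_lin_ext:
  assumes "vector_space V"
  shows "lin_ext V f (lin_ext fscale h r) = lin_ext V (\<lambda>i. lin_ext V f (h i)) r"
  by (rule linear_of_lin_ext[OF linear_lin_ext[OF assms]])

text \<open>Here the argument \<open>r\<close> is fixed and the map being extended varies linearly
  with a parameter. This gives linearity of iterated contractions in their outer variables.\<close>

lemma linear_lin_ext_param:
  assumes V: "vector_space V" and f: "\<And>i. Vector_Spaces.linear s V (\<lambda>a. f a i)"
    and s: "vector_space s"
  shows "Vector_Spaces.linear s V (\<lambda>a. lin_ext V (f a) r)"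
proof -
  interpret vector_space V by (rule V)
  have add: "f (a + b) i = f a i + f b i" and sc: "f (s c a) i = V c (f a i)" for a b c i
    using f[of i] by (simp_all add: Vector_Spaces.linear_iff)
  show ?thesis
    unfolding Vector_Spaces.linear_iff
  proof (intro conjI allI s V)
    show "lin_ext V (f (a + b)) r = lin_ext V (f a) r + lin_ext V (f b) r" for a b
      by (simp add: lin_ext_def add sum.distrib scale_right_distrib)
    show "lin_ext V (f (s c a)) r = V c (lin_ext V (f a) r)" for c a
      by (simp add: lin_ext_def sc scale_sum_right mult.commute)
  qed
qed

text \<open>A basis of \<open>U\<close> stays independent after adjoining \<open>r\<close>, so some
  linear functional vanishes on \<open>U\<close> and takes the value 1 at \<open>r\<close>. It is
  given by its values on generators, since bilinear and trilinear forms will be read off from those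
  values.\<close>

lemma lin_ext_separating:
  fixes U :: "('x, 'k::field) free set"
  assumes U: "module.subspace fscale U" and "r \<notin> U"
  obtains f :: "'x \<Rightarrow> 'k"
  where "\<And>q. q \<in> U \<Longrightarrow> lin_ext (*) f q = 0" and "lin_ext (*) f r = 1"
proof -
  interpret F: vector_space "fscale :: 'k \<Rightarrow> ('x, 'k) free \<Rightarrow> _"
    by (rule vector_space_fscale)
  interpret P: vector_space_pair "fscale :: 'k \<Rightarrow> ('x, 'k) free \<Rightarrow> _" "(*) :: 'k \<Rightarrow> 'k \<Rightarrow> 'k"
    using vector_space_mult by (unfold_locales) (auto simp: vector_space_def)
  obtain B where B: "B \<subseteq> U" "F.independent B" "U \<subseteq> F.span B"
    using F.maximal_independent_subset[of "U"] .
  have r: "r \<notin> F.span B"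
    using assms F.span_minimal[OF B(1) U] by blast
  then have "F.independent (insert r B)"
    using B(2) by (rule F.independent_insertI)
  from P.linear_independent_extend[OF this, of "\<lambda>x. if x = r then 1 else 0"]
  obtain \<phi> where lin: "Vector_Spaces.linear fscale (*) \<phi>"
    and \<phi>: "\<forall>x\<in>insert r B. \<phi> x = (if x = r then 1 else 0)"
    by blast
  have zero: "\<phi> q = 0" if "q \<in> U" for q
  proof (rule P.linear_eq_0_on_span[OF lin])
    show "q \<in> F.span B" using that B(3) by blast
    show "\<phi> b = 0" if "b \<in> B" for b
      using that \<phi> r F.span_base[of b B] by auto
  qed
  \<comment> \<open>A functional on the free space is the linear extension of its restriction to the
    generators.\<close>
  have "lin_ext (*) (\<lambda>i. \<phi> (gen i)) p = \<phi> p" for p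
  proof -
    have "p = lin_ext fscale gen p"
    proof (rule poly_mapping_eqI)
      fix k
      have "Poly_Mapping.lookup (lin_ext fscale gen p) k
        = (\<Sum>i\<in>Poly_Mapping.keys p. if i = k then Poly_Mapping.lookup p i else 0)"
        unfolding lin_ext_def lookup_sum
        by (intro sum.cong refl) (simp add: gen_def lookup_single when_def)
      then show "Poly_Mapping.lookup p k = Poly_Mapping.lookup (lin_ext fscale gen p) k"
        by (simp add: in_keys_iff)
    qed
    then have "\<phi> p = \<phi> (lin_ext fscale gen p)" by simp
    also have "\<dots> = lin_ext (*) (\<lambda>i. \<phi> (gen i)) p"
      by (rule linear_of_lin_ext[OF lin])
    finally show ?thesis ..
  qed
  then show thesis using that[of "\<lambda>i. \<phi> (gen i)"] zero \<phi> by simp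
qed

subsection \<open>Cosets\<close>

text \<open>The common shape of \<open>cls2\<close> and \<open>cls3\<close>, so that coset
  arithmetic is done once for both tensor products.\<close>

definition coset :: "'r::ab_group_add set \<Rightarrow> 'r \<Rightarrow> 'r set"
  where "coset U r = {q. q - r \<in> U}"

context
  fixes U :: "('x, 'k::field) free set"
  assumes U: "module.subspace fscale U"
begin

lemma subspace_closed:
  shows "0 \<in> U" and "r \<in> U \<Longrightarrow> q \<in> U \<Longrightarrow> r + q \<in> U" and "r \<in> U \<Longrightarrow> q \<in> U \<Longrightarrow> r - q \<in> U"
proof -
  interpret F: vector_space "fscale :: 'k \<Rightarrow> ('x, 'k) free \<Rightarrow> _"
    by (rule vector_space_fscale)
  show "0 \<in> U" and "r \<in> U \<Longrightarrow> q \<in> U \<Longrightarrow> r + q \<in> U" and "r \<in> U \<Longrightarrow> q \<in> U \<Longrightarrow> r - q \<in> U"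
    using U by (blast intro: F.subspace_0 F.subspace_add F.subspace_diff)+
qed

lemma coset_eq_iff: "coset U r = coset U q \<longleftrightarrow> r - q \<in> U"
proof
  assume "coset U r = coset U q"
  moreover have "r \<in> coset U r" by (simp add: coset_def subspace_closed)
  ultimately show "r - q \<in> U" by (simp add: coset_def)
next
  assume rq: "r - q \<in> U"
  have "x - r \<in> U \<longleftrightarrow> x - q \<in> U" for x
    using subspace_closed(2)[OF _ rq, of "x - r"] subspace_closed(3)[OF _ rq, of "x - q"] by auto
  then show "coset U r = coset U q" by (simp add: coset_def)
qed

text \<open>The only information about the arbitrary choice in \<open>rep\<close>: it changes a
  representative by an element of \<open>U\<close>.\<close>

lemma rep_coset: "rep (coset U r) - r \<in> U"
proof -
  have "r \<in> coset U r" by (simp add: coset_def subspace_closed)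
  then have "rep (coset U r) \<in> coset U r" unfolding rep_def by (rule someI)
  then show ?thesis by (simp add: coset_def)
qed

lemma tplus_coset: "coset U r \<oplus> coset U q = coset U (r + q)"
proof (intro set_eqI iffI)
  fix x assume "x \<in> coset U r \<oplus> coset U q"
  then obtain p p' where p: "p - r \<in> U" "p' - q \<in> U" "x = p + p'"
    by (auto simp: tplus_def coset_def)
  then show "x \<in> coset U (r + q)"
    using subspace_closed(2)[OF p(1,2)] by (simp add: coset_def add_diff_add)
next
  fix x assume "x \<in> coset U (r + q)"
  \<comment> \<open>For the reverse inclusion the whole deviation from \<open>r + q\<close> is put
    into the first summand.\<close>
  then have "x - q \<in> coset U r" "q \<in> coset U q" "x = (x - q) + q"
    by (simp_all add: coset_def subspace_closed algebra_simps)
  then show "x \<in> coset U r \<oplus> coset U q" unfolding tplus_def by blast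
qed

lemma tminus_coset: "coset U r \<ominus> coset U q = coset U (r - q)"
proof (intro set_eqI iffI)
  fix x assume "x \<in> coset U r \<ominus> coset U q"
  then obtain p p' where p: "p - r \<in> U" "p' - q \<in> U" "x = p - p'"
    by (auto simp: tminus_def coset_def)
  have "x - (r - q) = (p - r) - (p' - q)" by (simp add: p(3))
  then show "x \<in> coset U (r - q)"
    using subspace_closed(3)[OF p(1,2)] by (simp only: coset_def mem_Collect_eq)
next
  fix x assume "x \<in> coset U (r - q)"
  then have "x + q \<in> coset U r" "q \<in> coset U q" "x = (x + q) - q"
    by (simp_all add: coset_def subspace_closed algebra_simps)
  then show "x \<in> coset U r \<ominus> coset U q" unfolding tminus_def by blast
qed

end

section \<open>The relation subspaces of the twofold and threefold tensor products\<close>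

lemma subspace_null2: "module.subspace fscale (null2 s)"
  unfolding null2_def by (rule module.subspace_span) (simp add: module_iff_vector_space vector_space_fscale)

lemma subspace_null3: "module.subspace fscale (null3 s)"
  unfolding null3_def by (rule module.subspace_span) (simp add: module_iff_vector_space vector_space_fscale)

lemma null2_gen:
  shows "gen (a + a', b) - gen (a, b) - gen (a', b) \<in> null2 s"
    and "gen (a, b + b') - gen (a, b) - gen (a, b') \<in> null2 s"
    and "gen (s c a, b) - fscale c (gen (a, b)) \<in> null2 s"
    and "gen (a, s c b) - fscale c (gen (a, b)) \<in> null2 s"
proof -
  have "module fscale" by (simp add: module_iff_vector_space vector_space_fscale)
  note base = module.span_base[OF this]
  show "gen (a + a', b) - gen (a, b) - gen (a', b) \<in> null2 s"
    unfolding null2_def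
    by (rule base, rule UnI1, rule UnI1, rule UnI1, rule CollectI, intro exI conjI TrueI, rule refl)
  show "gen (a, b + b') - gen (a, b) - gen (a, b') \<in> null2 s"
    unfolding null2_def
    by (rule base, rule UnI1, rule UnI1, rule UnI2, rule CollectI, intro exI conjI TrueI, rule refl)
  show "gen (s c a, b) - fscale c (gen (a, b)) \<in> null2 s"
    unfolding null2_def
    by (rule base, rule UnI1, rule UnI2, rule CollectI, intro exI conjI TrueI, rule refl)
  show "gen (a, s c b) - fscale c (gen (a, b)) \<in> null2 s"
    unfolding null2_def
    by (rule base, rule UnI2, rule CollectI, intro exI conjI TrueI, rule refl)
qed

lemma null3_gen:
  shows "gen (a + a', b, d) - gen (a, b, d) - gen (a', b, d) \<in> null3 s"
    and "gen (a, b + b', d) - gen (a, b, d) - gen (a, b', d) \<in> null3 s"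
    and "gen (a, b, d + d') - gen (a, b, d) - gen (a, b, d') \<in> null3 s"
    and "gen (s c a, b, d) - fscale c (gen (a, b, d)) \<in> null3 s"
    and "gen (a, s c b, d) - fscale c (gen (a, b, d)) \<in> null3 s"
    and "gen (a, b, s c d) - fscale c (gen (a, b, d)) \<in> null3 s"
proof -
  have "module fscale" by (simp add: module_iff_vector_space vector_space_fscale)
  note base = module.span_base[OF this]
  show "gen (a + a', b, d) - gen (a, b, d) - gen (a', b, d) \<in> null3 s"
    unfolding null3_def
    by (rule base, rule UnI1, rule UnI1, rule UnI1, rule UnI1, rule UnI1, rule CollectI, intro exI conjI TrueI, rule refl)
  show "gen (a, b + b', d) - gen (a, b, d) - gen (a, b', d) \<in> null3 s"
    unfolding null3_def
    by (rule base, rule UnI1, rule UnI1, rule UnI1, rule UnI1, rule UnI2, rule CollectI, intro exI conjI TrueI, rule refl)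
  show "gen (a, b, d + d') - gen (a, b, d) - gen (a, b, d') \<in> null3 s"
    unfolding null3_def
    by (rule base, rule UnI1, rule UnI1, rule UnI1, rule UnI2, rule CollectI, intro exI conjI TrueI, rule refl)
  show "gen (s c a, b, d) - fscale c (gen (a, b, d)) \<in> null3 s"
    unfolding null3_def
    by (rule base, rule UnI1, rule UnI1, rule UnI2, rule CollectI, intro exI conjI TrueI, rule refl)
  show "gen (a, s c b, d) - fscale c (gen (a, b, d)) \<in> null3 s"
    unfolding null3_def
    by (rule base, rule UnI1, rule UnI2, rule CollectI, intro exI conjI TrueI, rule refl)
  show "gen (a, b, s c d) - fscale c (gen (a, b, d)) \<in> null3 s"
    unfolding null3_def
    by (rule base, rule UnI2, rule CollectI, intro exI conjI TrueI, rule refl)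
qed

lemma cls2_coset: "cls2 s r = coset (null2 s) r"
  by (simp add: cls2_def coset_def)

lemma cls3_coset: "cls3 s r = coset (null3 s) r"
  by (simp add: cls3_def coset_def)

subsection \<open>Twofold tensors as arguments of bilinear maps\<close>

text \<open>Since \<open>Vector_Spaces.linear\<close> includes the vector space axioms of source and
  target, this predicate carries them too.\<close>

definition bilin ::
    "('k::field \<Rightarrow> 'a \<Rightarrow> 'a::ab_group_add) \<Rightarrow> ('k \<Rightarrow> 'v \<Rightarrow> 'v::ab_group_add) \<Rightarrow> ('a \<Rightarrow> 'a \<Rightarrow> 'v) \<Rightarrow> bool"
  where "bilin s V f \<longleftrightarrow>
    (\<forall>b. Vector_Spaces.linear s V (\<lambda>a. f a b)) \<and> (\<forall>a. Vector_Spaces.linear s V (f a))"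

lemma bilinI:
  assumes "vector_space s" "vector_space V"
    and "\<And>a a' b. f (a + a') b = f a b + f a' b" "\<And>a b b'. f a (b + b') = f a b + f a b'"
    and "\<And>c a b. f (s c a) b = V c (f a b)" "\<And>c a b. f a (s c b) = V c (f a b)"
  shows "bilin s V f"
  unfolding bilin_def Vector_Spaces.linear_iff by (intro conjI allI assms)

lemma bilin_vector_space:
  assumes "bilin s V f"
  shows "vector_space s" "vector_space V"
  using assms by (simp_all add: bilin_def Vector_Spaces.linear_iff)

lemma bilin_simps:
  assumes "bilin s V f"
  shows "f (a + a') b = f a b + f a' b" "f a (b + b') = f a b + f a b'"
    "f (s c a) b = V c (f a b)" "f a (s c b) = V c (f a b)"
proof -
  interpret L: Vector_Spaces.linear s V "\<lambda>a. f a b" using assms by (simp add: bilin_def)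
  interpret R: Vector_Spaces.linear s V "f a" using assms by (simp add: bilin_def)
  show "f (a + a') b = f a b + f a' b" "f (s c a) b = V c (f a b)" by (rule L.add, rule L.scale)
  show "f a (b + b') = f a b + f a b'" "f a (s c b) = V c (f a b)" by (rule R.add, rule R.scale)
qed

text \<open>A bilinear map kills each of the four kinds of relation, hence their span. This is the
  universal property of the tensor product.\<close>

lemma lin_ext_null2:
  assumes f: "bilin s V f" and r: "r \<in> null2 s"
  shows "lin_ext V (\<lambda>(a, b). f a b) r = 0"
proof -
  note V = bilin_vector_space(2)[OF f]
  interpret Vector_Spaces.linear fscale V "lin_ext V (\<lambda>(a, b). f a b)"
    using V by (rule linear_lin_ext)
  show ?thesis
    using r unfolding null2_def
  proof (rule eq_0_on_span[rotated], goal_cases)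
    case (1 x)
    from 1 show ?case
      by (elim UnE CollectE exE conjE) (simp_all add: diff scale lin_ext_gen[OF V] bilin_simps[OF f])
  qed
qed

text \<open>Well-definedness: the representative chosen inside \<open>tlift\<close> differs from
  \<open>r\<close> by a relation, which a bilinear map does not see.\<close>

lemma tlift_cls2:
  assumes f: "bilin s V f"
  shows "tlift V f (cls2 s r) = lin_ext V (\<lambda>(a, b). f a b) r"
proof -
  interpret Vector_Spaces.linear fscale V "lin_ext V (\<lambda>(a, b). f a b)"
    using bilin_vector_space(2)[OF f] by (rule linear_lin_ext)
  have "rep (cls2 s r) - r \<in> null2 s"
    unfolding cls2_coset by (rule rep_coset[OF subspace_null2])
  from lin_ext_null2[OF f this] show ?thesis by (simp add: diff tlift_def)
qed

section \<open>Evaluation of bilinear maps on sums, products, brackets and images of tensors\<close>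

lemma cls2_in_tensor_space [simp]: "cls2 s r \<in> tensor_space s"
  by (simp add: tensor_space_def)

lemma pure2_in_tensor_space [simp]: "a \<otimes>\<^bsub>s\<^esub> b \<in> tensor_space s"
  by (simp add: pure2_def)

lemma tmult_in_tensor_space [simp]: "t \<odot>\<^bsub>s\<^esub> u \<in> tensor_space s"
  by (simp add: tmult_def)

lemma tbracket_in_tensor_space [simp]: "tbracket s br t u \<in> tensor_space s"
  by (simp add: tbracket_def)

lemma tmap_in_tensor_space [simp]: "tmap s h k t \<in> tensor_space s"
  by (simp add: tmap_def)

lemma tplus_cls2: "cls2 s r \<oplus> cls2 s q = cls2 s (r + q)"
  unfolding cls2_coset by (rule tplus_coset[OF subspace_null2])

lemma tminus_cls2: "cls2 s r \<ominus> cls2 s q = cls2 s (r - q)"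
  unfolding cls2_coset by (rule tminus_coset[OF subspace_null2])

lemma
  assumes "t \<in> tensor_space s" "u \<in> tensor_space s"
  shows tplus_in_tensor_space [simp]: "t \<oplus> u \<in> tensor_space s"
    and tminus_in_tensor_space [simp]: "t \<ominus> u \<in> tensor_space s"
  using assms by (auto simp: tensor_space_def tplus_cls2 tminus_cls2)

lemma tlift_pure2:
  assumes "bilin s V f"
  shows "tlift V f (a \<otimes>\<^bsub>s\<^esub> b) = f a b"
  by (simp add: pure2_def tlift_cls2[OF assms] lin_ext_gen[OF bilin_vector_space(2)[OF assms]])

lemma
  assumes f: "bilin s V f" and t: "t \<in> tensor_space s" and u: "u \<in> tensor_space s"
  shows tlift_tplus: "tlift V f (t \<oplus> u) = tlift V f t + tlift V f u"
    and tlift_tminus: "tlift V f (t \<ominus> u) = tlift V f t - tlift V f u"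
proof -
  interpret Vector_Spaces.linear fscale V "lin_ext V (\<lambda>(a, b). f a b)"
    using bilin_vector_space(2)[OF f] by (rule linear_lin_ext)
  obtain r q where "t = cls2 s r" "u = cls2 s q"
    using t u by (auto simp: tensor_space_def)
  then show "tlift V f (t \<oplus> u) = tlift V f t + tlift V f u"
    and "tlift V f (t \<ominus> u) = tlift V f t - tlift V f u"
    by (simp_all add: tplus_cls2 tminus_cls2 tlift_cls2[OF f] add diff)
qed

lemma tlift_tscale:
  assumes f: "bilin s V f"
  shows "tlift V f (tscale s c t) = V c (tlift V f t)"
proof -
  interpret Vector_Spaces.linear fscale V "lin_ext V (\<lambda>(a, b). f a b)"
    using bilin_vector_space(2)[OF f] by (rule linear_lin_ext)
  show ?thesis unfolding tscale_def tlift_cls2[OF f] scale by (simp add: tlift_def)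
qed

text \<open>Both sides use the same representatives of \<open>t\<close> and \<open>u\<close>.
  Bilinearity of \<open>f\<close> lets the outer class be evaluated on the product formed from them;
  the rest is nesting of linear extensions.\<close>

lemma tlift_tmult:
  assumes f: "bilin s V f"
  shows "tlift V f (t \<odot>\<^bsub>s\<^esub> u) = tlift V (\<lambda>a b. tlift V (\<lambda>c d. f (a * c) (b * d)) u) t"
  using bilin_vector_space(2)[OF f]
  unfolding tmult_def tlift_cls2[OF f]
  by (simp add: bilin_ext_def lin_ext_lin_ext lin_ext_gen tlift_def split_def)

lemma tlift_tbracket:
  assumes f: "bilin s V f"
  shows "tlift V f (tbracket s br t u) =
    tlift V (\<lambda>a b. tlift V (\<lambda>c d. f (a * c) (br b d) + f (br a c) (b * d)) u) t"
proof -
  note V = bilin_vector_space(2)[OF f]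
  interpret Vector_Spaces.linear fscale V "lin_ext V (\<lambda>(a, b). f a b)"
    using V by (rule linear_lin_ext)
  show ?thesis
    using V add unfolding tbracket_def tlift_cls2[OF f]
    by (simp add: bilin_ext_def lin_ext_lin_ext lin_ext_gen tlift_def split_def)
qed

lemma tlift_tmap:
  assumes f: "bilin s V f"
  shows "tlift V f (tmap s h k t) = tlift V (\<lambda>a b. f (h a) (k b)) t"
  using bilin_vector_space(2)[OF f]
  unfolding tmap_def tlift_cls2[OF f]
  by (simp add: lin_ext_lin_ext lin_ext_gen tlift_def split_def)

lemma tlift_add:
  assumes "vector_space V"
  shows "tlift V (\<lambda>a b. f a b + h a b) t = tlift V f t + tlift V h t"
  by (simp add: tlift_def lin_ext_def split_def sum.distrib vector_space.vector_space_assms(1)[OF assms])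

lemma tlift_zero:
  assumes "vector_space V"
  shows "tlift V (\<lambda>a b. 0) t = 0"
proof -
  interpret vector_space V by fact
  show ?thesis by (simp add: tlift_def lin_ext_def split_def)
qed

lemma linear_of_tlift:
  assumes "Vector_Spaces.linear V W L"
  shows "L (tlift V f t) = tlift W (\<lambda>a b. L (f a b)) t"
  by (simp add: tlift_def linear_of_lin_ext[OF assms] split_def)

text \<open>If the cosets differed, a functional vanishing on the relations would separate them; its
  values on generators form a bilinear form on which \<open>t\<close> and \<open>u\<close>
  disagree.\<close>

lemma tensor2_eqI:
  fixes s :: "'k::field \<Rightarrow> 'a::ab_group_add \<Rightarrow> 'a"
  assumes s: "vector_space s" and t: "t \<in> tensor_space s" and u: "u \<in> tensor_space s"
    and eq: "\<And>f :: 'a \<Rightarrow> 'a \<Rightarrow> 'k. bilin s (*) f \<Longrightarrow> tlift (*) f t = tlift (*) f u"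
  shows "t = u"
proof (rule ccontr)
  obtain r q where rq: "t = cls2 s r" "u = cls2 s q"
    using t u by (auto simp: tensor_space_def)
  assume "t \<noteq> u"
  then have "r - q \<notin> null2 s"
    by (simp add: rq cls2_coset coset_eq_iff[OF subspace_null2])
  then obtain f where vanish: "\<And>p. p \<in> null2 s \<Longrightarrow> lin_ext (*) f p = 0"
    and f: "lin_ext (*) f (r - q) = 1"
    by (rule lin_ext_separating[OF subspace_null2]) blast
  interpret Vector_Spaces.linear fscale "(*)" "lin_ext (*) f"
    by (rule linear_lin_ext[OF vector_space_mult])
  note gen = lin_ext_gen[OF vector_space_mult, of f]
  \<comment> \<open>Each law of bilinearity is the vanishing of the functional on one kind of
    relation.\<close>
  have "f (a + a', b) = f (a, b) + f (a', b)" "f (a, b + b') = f (a, b) + f (a, b')"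
    "f (s c a, b) = c * f (a, b)" "f (a, s c b) = c * f (a, b)" for a a' b b' c
    using null2_gen[THEN vanish] by (simp_all add: diff add scale gen algebra_simps)
  then have b: "bilin s (*) (\<lambda>a b. f (a, b))"
    using s vector_space_mult by (intro bilinI) simp_all
  have "lin_ext (*) f r = lin_ext (*) f q"
    using eq[OF b] by (simp add: rq tlift_cls2[OF b])
  then show False using f by (simp add: diff)
qed

section \<open>Elementary properties of bilinear maps and constructions that preserve
  bilinearity\<close>

lemma bilin_zero:
  assumes "bilin s V f"
  shows "f 0 b = 0" "f a 0 = 0"
proof -
  interpret L: Vector_Spaces.linear s V "\<lambda>a. f a b" using assms by (simp add: bilin_def)
  interpret R: Vector_Spaces.linear s V "f a" using assms by (simp add: bilin_def)
  show "f 0 b = 0" "f a 0 = 0" by (rule L.zero, rule R.zero)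
qed

lemma bilin_compose:
  assumes f: "bilin s V f" and h: "Vector_Spaces.linear s' s h" and k: "Vector_Spaces.linear s' s k"
  shows "bilin s' V (\<lambda>a b. f (h a) (k b))"
proof -
  interpret h: Vector_Spaces.linear s' s h by fact
  interpret k: Vector_Spaces.linear s' s k by fact
  show ?thesis
    using bilin_vector_space(2)[OF f] h.vs1.vector_space_axioms
    by (intro bilinI) (simp_all add: h.add k.add h.scale k.scale bilin_simps[OF f])
qed

lemma bilin_add:
  assumes f: "bilin s V f" and h: "bilin s V h"
  shows "bilin s V (\<lambda>a b. f a b + h a b)"
proof -
  interpret vector_space V by (rule bilin_vector_space(2)[OF f])
  show ?thesis
    using bilin_vector_space[OF f]
    by (intro bilinI) (simp_all add: bilin_simps[OF f] bilin_simps[OF h] scale_right_distrib)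
qed

lemma linear_tlift_param:
  assumes "\<And>c d. Vector_Spaces.linear s V (\<lambda>a. f a c d)"
  shows "Vector_Spaces.linear s V (\<lambda>a. tlift V (f a) t)"
proof -
  have "vector_space s" "vector_space V" using assms unfolding Vector_Spaces.linear_iff by auto
  then show ?thesis
    unfolding tlift_def using assms
    by (intro linear_lin_ext_param) (auto simp: split_def)
qed

lemma bilin_tlift:
  assumes "\<And>c d. bilin s V (\<lambda>a b. f a b c d)"
  shows "bilin s V (\<lambda>a b. tlift V (f a b) t)"
  using assms unfolding bilin_def by (auto intro!: linear_tlift_param)

subsection \<open>Threefold tensors as arguments of trilinear maps\<close>

definition trilin ::
    "('k::field \<Rightarrow> 'a \<Rightarrow> 'a::ab_group_add) \<Rightarrow> ('k \<Rightarrow> 'v \<Rightarrow> 'v::ab_group_add) \<Rightarrow> ('a \<Rightarrow> 'a \<Rightarrow> 'a \<Rightarrow> 'v) \<Rightarrow> bool"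
  where "trilin s V f \<longleftrightarrow> (\<forall>c. bilin s V (\<lambda>a b. f a b c)) \<and> (\<forall>a. bilin s V (f a))"

definition tlift3 ::
    "('k::field \<Rightarrow> 'v \<Rightarrow> 'v::ab_group_add) \<Rightarrow> ('a \<Rightarrow> 'a \<Rightarrow> 'a \<Rightarrow> 'v) \<Rightarrow> ('a, 'k) tensor3 \<Rightarrow> 'v"
  where "tlift3 V f t = lin_ext V (\<lambda>(a, b, c). f a b c) (rep t)"

lemma trilin_vector_space:
  assumes "trilin s V f"
  shows "vector_space V"
  using assms bilin_vector_space(2) unfolding trilin_def by blast

lemma trilin_simps:
  assumes "trilin s V f"
  shows "f (a + a') b d = f a b d + f a' b d" "f a (b + b') d = f a b d + f a b' d"
    "f a b (d + d') = f a b d + f a b d'" "f (s c a) b d = V c (f a b d)"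
    "f a (s c b) d = V c (f a b d)" "f a b (s c d) = V c (f a b d)"
proof -
  have L: "bilin s V (\<lambda>a b. f a b d)" and R: "bilin s V (f a)" for a d
    using assms by (auto simp: trilin_def)
  show "f (a + a') b d = f a b d + f a' b d" by (rule bilin_simps(1)[OF L])
  show "f a (b + b') d = f a b d + f a b' d" by (rule bilin_simps(2)[OF L])
  show "f a b (d + d') = f a b d + f a b d'" by (rule bilin_simps(2)[OF R])
  show "f (s c a) b d = V c (f a b d)" by (rule bilin_simps(3)[OF L])
  show "f a (s c b) d = V c (f a b d)" by (rule bilin_simps(4)[OF L])
  show "f a b (s c d) = V c (f a b d)" by (rule bilin_simps(4)[OF R])
qed

lemma lin_ext_null3:
  assumes f: "trilin s V f" and r: "r \<in> null3 s"
  shows "lin_ext V (\<lambda>(a, b, c). f a b c) r = 0"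
proof -
  note V = trilin_vector_space[OF f]
  interpret Vector_Spaces.linear fscale V "lin_ext V (\<lambda>(a, b, c). f a b c)"
    using V by (rule linear_lin_ext)
  show ?thesis
    using r unfolding null3_def
  proof (rule eq_0_on_span[rotated], goal_cases)
    case (1 x)
    from 1 show ?case
      by (elim UnE CollectE exE conjE) (simp_all add: diff scale lin_ext_gen[OF V] trilin_simps[OF f])
  qed
qed

lemma tlift3_cls3:
  assumes f: "trilin s V f"
  shows "tlift3 V f (cls3 s r) = lin_ext V (\<lambda>(a, b, c). f a b c) r"
proof -
  interpret Vector_Spaces.linear fscale V "lin_ext V (\<lambda>(a, b, c). f a b c)"
    using trilin_vector_space[OF f] by (rule linear_lin_ext)
  have "rep (cls3 s r) - r \<in> null3 s"
    unfolding cls3_coset by (rule rep_coset[OF subspace_null3])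
  from lin_ext_null3[OF f this] show ?thesis by (simp add: diff tlift3_def)
qed

lemma tplus_cls3: "cls3 s r \<oplus> cls3 s q = cls3 s (r + q)"
  unfolding cls3_coset by (rule tplus_coset[OF subspace_null3])

lemma tlift3_tplus:
  assumes f: "trilin s V f" and t: "t \<in> range (cls3 s)" and u: "u \<in> range (cls3 s)"
  shows "tlift3 V f (t \<oplus> u) = tlift3 V f t + tlift3 V f u"
proof -
  interpret Vector_Spaces.linear fscale V "lin_ext V (\<lambda>(a, b, c). f a b c)"
    using trilin_vector_space[OF f] by (rule linear_lin_ext)
  obtain r q where "t = cls3 s r" "u = cls3 s q"
    using t u by auto
  then show ?thesis by (simp add: tplus_cls3 tlift3_cls3[OF f] add)
qed

lemma
  assumes f: "trilin s V f"
  shows tlift3_tensor_elt: "tlift3 V f (tensor_elt s t c) = tlift V (\<lambda>a b. f a b c) t"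
    and tlift3_elt_tensor: "tlift3 V f (elt_tensor s a t) = tlift V (f a) t"
  unfolding tensor_elt_def elt_tensor_def tlift3_cls3[OF f] using trilin_vector_space[OF f]
  by (simp_all add: lin_ext_lin_ext lin_ext_gen tlift_def split_def)

text \<open>The representatives chosen for \<open>\<Delta> a\<close> inside
  \<open>comult_left\<close> and \<open>comult_right\<close> disappear under a trilinear map,
  leaving an iterated contraction.\<close>

lemma
  assumes f: "trilin s V f"
  shows tlift3_comult_left:
      "tlift3 V f (comult_left s \<Delta> t) = tlift V (\<lambda>a c. tlift V (\<lambda>a1 a2. f a1 a2 c) (\<Delta> a)) t"
    and tlift3_comult_right:
      "tlift3 V f (comult_right s \<Delta> t) = tlift V (\<lambda>a c. tlift V (f a) (\<Delta> c)) t"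
proof -
  note V = trilin_vector_space[OF f]
  have "tlift3 V f (comult_left s \<Delta> t) = tlift V (\<lambda>a c. tlift3 V f (tensor_elt s (\<Delta> a) c)) t"
    unfolding comult_left_def tlift3_cls3[OF f] using V
    by (simp add: lin_ext_lin_ext tlift_def tlift3_def split_def)
  then show "tlift3 V f (comult_left s \<Delta> t) = tlift V (\<lambda>a c. tlift V (\<lambda>a1 a2. f a1 a2 c) (\<Delta> a)) t"
    by (simp add: tlift3_tensor_elt[OF f])
  have "tlift3 V f (comult_right s \<Delta> t) = tlift V (\<lambda>a c. tlift3 V f (elt_tensor s a (\<Delta> c))) t"
    unfolding comult_right_def tlift3_cls3[OF f] using V
    by (simp add: lin_ext_lin_ext tlift_def tlift3_def split_def)
  then show "tlift3 V f (comult_right s \<Delta> t) = tlift V (\<lambda>a c. tlift V (f a) (\<Delta> c)) t"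
    by (simp add: tlift3_elt_tensor[OF f])
qed

text \<open>The separation argument for twofold tensors, now with a functional whose values on
  generators form a trilinear form.\<close>

lemma tensor3_eqI:
  fixes s :: "'k::field \<Rightarrow> 'a::ab_group_add \<Rightarrow> 'a"
  assumes s: "vector_space s" and t: "t \<in> range (cls3 s)" and u: "u \<in> range (cls3 s)"
    and eq: "\<And>f :: 'a \<Rightarrow> 'a \<Rightarrow> 'a \<Rightarrow> 'k. trilin s (*) f \<Longrightarrow> tlift3 (*) f t = tlift3 (*) f u"
  shows "t = u"
proof (rule ccontr)
  obtain r q where rq: "t = cls3 s r" "u = cls3 s q"
    using t u by auto
  assume "t \<noteq> u"
  then have "r - q \<notin> null3 s"
    by (simp add: rq cls3_coset coset_eq_iff[OF subspace_null3])
  then obtain f where vanish: "\<And>p. p \<in> null3 s \<Longrightarrow> lin_ext (*) f p = 0"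
    and f: "lin_ext (*) f (r - q) = 1"
    by (rule lin_ext_separating[OF subspace_null3]) blast
  interpret Vector_Spaces.linear fscale "(*)" "lin_ext (*) f"
    by (rule linear_lin_ext[OF vector_space_mult])
  note gen = lin_ext_gen[OF vector_space_mult, of f]
  have "f (a + a', b, d) = f (a, b, d) + f (a', b, d)" "f (a, b + b', d) = f (a, b, d) + f (a, b', d)"
    "f (a, b, d + d') = f (a, b, d) + f (a, b, d')" "f (s c a, b, d) = c * f (a, b, d)"
    "f (a, s c b, d) = c * f (a, b, d)" "f (a, b, s c d) = c * f (a, b, d)" for a a' b b' c d d'
    using null3_gen[THEN vanish] by (simp_all add: diff add scale gen algebra_simps)
  then have b: "trilin s (*) (\<lambda>a b d. f (a, b, d))"
    unfolding trilin_def using s vector_space_mult by (intro conjI allI bilinI) simp_all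
  have "lin_ext (*) f r = lin_ext (*) f q"
    using eq[OF b] by (simp add: rq tlift3_cls3[OF b])
  then show False using f by (simp add: diff)
qed

subsection \<open>Poisson Hopf algebras\<close>

text \<open>Turns the linearity of \<Delta>, an equation between cosets, into linearity of an
  ordinary map between vector spaces.\<close>

lemma (in hopf_algebra) linear_tlift_comult:
  assumes f: "bilin scale V f"
  shows "Vector_Spaces.linear scale V (\<lambda>a. tlift V f (\<Delta> a))"
  unfolding Vector_Spaces.linear_iff
  using bilin_vector_space[OF f]
  by (simp add: comult_add comult_scale tlift_tplus[OF f] comult_in tlift_tscale[OF f])

lemma (in k_algebra) linear_mult_left: "Vector_Spaces.linear scale scale (\<lambda>a. a * b)"
  and linear_mult_right: "Vector_Spaces.linear scale scale (\<lambda>a. b * a)"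
proof -
  have "scale c (b * a) = b * scale c a" for a b c
    by (metis scale_mult_left mult.commute)
  then show "Vector_Spaces.linear scale scale (\<lambda>a. a * b)" "Vector_Spaces.linear scale scale (\<lambda>a. b * a)"
    using vector_space_axioms by (simp_all add: Vector_Spaces.linear_iff scale_mult_left algebra_simps)
qed

lemma (in k_algebra) bilin_times: "bilin scale scale (*)"
  unfolding bilin_def using linear_mult_left linear_mult_right by blast

text \<open>The antipode axiom at \<open>g\<close> reads S(g) g = \<epsilon>(g) 1 = 1, so S(g) is an
  inverse; inverses are unique, hence it is the one picked out by
  \<open>unit_inverse\<close>.\<close>

lemma (in hopf_algebra) group_like_unit:
  assumes "group_like scale \<Delta> \<epsilon> g"
  shows "g * unit_inverse g = 1"
proof -
  have "bilin scale scale (\<lambda>a b. S a * b)"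
    by (intro bilin_compose[OF bilin_times] antipode_linear linear_ident)
  from tlift_pure2[OF this, of g g] have inv: "g * S g = 1"
    using antipode_left[of g] assms by (simp add: group_like_def mult.commute)
  have "unit_inverse g = S g"
    unfolding unit_inverse_def
  proof (rule the_equality)
    show "g * S g = 1" by (rule inv)
    fix h assume "g * h = 1"
    then have "S g * (g * h) = S g" by simp
    then show "h = S g" using inv by (metis mult.assoc mult.commute mult_1)
  qed
  then show ?thesis using inv by simp
qed

lemma (in poisson_algebra) br_one_left: "br 1 a = 0"
proof -
  interpret L: Vector_Spaces.linear scale scale "\<lambda>x. br x y" for y by (rule br_linear_left)
  interpret R: Vector_Spaces.linear scale scale "br x" for x by (rule br_linear_right)
  \<comment> \<open>Polarising the alternating law gives antisymmetry; the Leibniz rule at 1 = 1 * 1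
    then gives {a, 1} = 2 {a, 1}.\<close>
  have "br (1 + a) (1 + a) = 0" by (rule br_alternating)
  then have "br 1 a + br a 1 = 0"
    unfolding L.add R.add by (simp add: br_alternating add.commute)
  then have "br 1 a = - br a 1" by (simp only: eq_neg_iff_add_eq_0)
  also have "br a 1 = 0" using br_leibniz[of a 1 1] by simp
  finally show ?thesis by simp
qed

lemma (in poisson_algebra) bilin_bracket:
  assumes "bilin scale V f"
  shows "bilin scale V (\<lambda>c d. f (a * c) (br b d) + f (br a c) (b * d))"
    and "bilin scale V (\<lambda>a b. f (a * c) (br b d) + f (br a c) (b * d))"
  by (intro bilin_add bilin_compose[OF assms] linear_mult_left linear_mult_right br_linear_left
      br_linear_right)+

lemma (in k_algebra) bilin_mult:
  assumes "bilin scale V f"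
  shows "bilin scale V (\<lambda>c d. f (a * c) (b * d))" and "bilin scale V (\<lambda>a b. f (a * c) (b * d))"
  by (intro bilin_compose[OF assms] linear_mult_left linear_mult_right)+

text \<open>The field as an algebra over itself, so that multiplication facts apply to scalar-valued
  forms.\<close>

lemma k_algebra_mult: "k_algebra ((*) :: 'k::field \<Rightarrow> 'k \<Rightarrow> 'k)"
  using vector_space_mult by (simp add: k_algebra_def k_algebra_axioms_def mult.assoc)

text \<open>Applying \<epsilon> \<otimes> \<epsilon> to \<Delta>({a, b}) = {\<Delta>(a),
  \<Delta>(b)} and contracting with the counit axioms produces \<epsilon>({a, b}) twice on the
  right. Cancelling one copy works in every characteristic.\<close>

lemma (in poisson_hopf_algebra) counit_br: "\<epsilon> (br a b) = 0"
proof -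
  interpret e: Vector_Spaces.linear scale "(*)" \<epsilon> by (rule counit_linear)
  have b: "bilin scale (*) (\<lambda>a b. \<epsilon> a * \<epsilon> b)"
    by (rule bilin_compose[OF k_algebra.bilin_times[OF k_algebra_mult] counit_linear counit_linear])
  \<comment> \<open>The counit axiom pushed through a linear functional, in the form needed for
    scalar-valued contractions.\<close>
  have counit: "tlift (*) (\<lambda>a b. \<epsilon> a * h b) (\<Delta> c) = h c"
    if "Vector_Spaces.linear scale (*) h" for h c
  proof -
    have "h (tlift scale (\<lambda>a b. scale (\<epsilon> a) b) (\<Delta> c)) = tlift (*) (\<lambda>a b. h (scale (\<epsilon> a) b)) (\<Delta> c)"
      by (rule linear_of_tlift[OF that])
    then show ?thesis
      using that by (simp add: counit_left Vector_Spaces.linear_iff)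
  qed
  have counit': "tlift (*) (\<lambda>a b. h a * \<epsilon> b) (\<Delta> c) = h c"
    if "Vector_Spaces.linear scale (*) h" for h c
  proof -
    have "h (tlift scale (\<lambda>a b. scale (\<epsilon> b) a) (\<Delta> c)) = tlift (*) (\<lambda>a b. h (scale (\<epsilon> b) a)) (\<Delta> c)"
      by (rule linear_of_tlift[OF that])
    then show ?thesis
      using that by (simp add: counit_right Vector_Spaces.linear_iff mult.commute)
  qed
  have l: "Vector_Spaces.linear scale (*) (\<lambda>b. \<epsilon> (br a b))"
    "Vector_Spaces.linear scale (*) (\<lambda>a. \<epsilon> (br a b))" for a b
    using Vector_Spaces.linear_compose[OF br_linear_right counit_linear]
      Vector_Spaces.linear_compose[OF br_linear_left counit_linear] by (simp_all add: o_def)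
  \<comment> \<open>Multiplicativity of \<epsilon> isolates a factor depending only on
    \<open>a1\<close> or \<open>a2\<close>; the counit axiom then removes one leg of
    \<Delta>(b).\<close>
  have inner: "tlift (*) (\<lambda>b1 b2. \<epsilon> (a1 * b1) * \<epsilon> (br a2 b2) + \<epsilon> (br a1 b1) * \<epsilon> (a2 * b2)) (\<Delta> b)
    = \<epsilon> a1 * \<epsilon> (br a2 b) + \<epsilon> (br a1 b) * \<epsilon> a2" for a1 a2
  proof -
    have "\<epsilon> (a1 * b1) * \<epsilon> (br a2 b2) = \<epsilon> a1 * (\<epsilon> b1 * \<epsilon> (br a2 b2))"
      "\<epsilon> (br a1 b1) * \<epsilon> (a2 * b2) = (\<epsilon> (br a1 b1) * \<epsilon> b2) * \<epsilon> a2" for b1 b2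
      by (simp_all add: counit_mult)
    then show ?thesis
      by (simp only: tlift_add[OF vector_space_mult] counit[OF l(1)] counit'[OF l(1)]
        linear_of_tlift[OF k_algebra.linear_mult_left[OF k_algebra_mult], symmetric]
        linear_of_tlift[OF k_algebra.linear_mult_right[OF k_algebra_mult], symmetric])
  qed
  have "\<epsilon> (br a b) = tlift (*) (\<lambda>a b. \<epsilon> a * \<epsilon> b) (\<Delta> (br a b))"
    by (rule counit[OF counit_linear, symmetric])
  also have "\<dots> = tlift (*) (\<lambda>a1 a2. \<epsilon> a1 * \<epsilon> (br a2 b) + \<epsilon> (br a1 b) * \<epsilon> a2) (\<Delta> a)"
    by (simp only: comult_br tlift_tbracket[OF b] inner)
  also have "\<dots> = \<epsilon> (br a b) + \<epsilon> (br a b)"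
    by (simp only: tlift_add[OF vector_space_mult] counit[OF l(2)] counit'[OF l(2)])
  finally show ?thesis by (simp only: add_cancel_right_left)
qed

subsection \<open>Poisson Hopf structures on a Poisson polynomial algebra\<close>

text \<open>\<open>B\<close> is the base algebra and \<open>H\<close> the polynomial algebra;
  \<open>[:0, 1:]\<close> is the variable x and \<open>[:b:]\<close> the constant b.\<close>

locale poisson_hopf_ore_extension =
  B: poisson_hopf_algebra s \<Delta> \<epsilon> S br + H: poisson_hopf_algebra "poly_scale s" \<Delta>P \<epsilon>P SP brP
  for s :: "'k::field \<Rightarrow> 'b::comm_ring_1 \<Rightarrow> 'b" and \<Delta> \<epsilon> S br \<Delta>P \<epsilon>P SP brP +
  fixes \<alpha> \<delta> :: "'b \<Rightarrow> 'b" and g :: 'b and w :: "('b, 'k) tensor2"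
  assumes ore: "poisson_polynomial_algebra s br \<alpha> \<delta> brP"
    and sub: "poisson_hopf_subalgebra_poly s \<Delta> \<epsilon> S br \<Delta>P \<epsilon>P SP brP"
    and counit_x: "\<epsilon>P [:0, 1:] = 0"
    and group_like: "group_like s \<Delta> \<epsilon> g"
    and w: "w \<in> tensor_space s"
    and comult_x: "\<Delta>P [:0, 1:] =
      [:g:] \<otimes>\<^bsub>poly_scale s\<^esub> [:0, 1:] \<oplus> [:0, 1:] \<otimes>\<^bsub>poly_scale s\<^esub> 1
        \<oplus> tmap (poly_scale s) (\<lambda>a. [:a:]) (\<lambda>a. [:a:]) w"
begin

lemma linear_coeff: "Vector_Spaces.linear (poly_scale s) s (\<lambda>p. coeff p i)"
  using B.vector_space_axioms H.vector_space_axioms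
  by (simp add: Vector_Spaces.linear_iff poly_scale_def flip: B.scale_mult_left)

text \<open>Such forms read off the coefficient at \<open>x^i\<close> \<otimes> \<open>x^j\<close>.
  They allow coefficients to be compared without decomposing the tensor square of the polynomial
  ring.\<close>

lemma bilin_coeff: "bilin s V f \<Longrightarrow> bilin (poly_scale s) V (\<lambda>p q. f (coeff p i) (coeff q j))"
  by (rule bilin_compose[OF _ linear_coeff linear_coeff])

lemma linear_\<alpha>: "Vector_Spaces.linear s s \<alpha>"
  and \<alpha>_mult: "\<alpha> (a * b) = \<alpha> a * b + a * \<alpha> b"
  and \<alpha>_br: "\<alpha> (br a b) = br (\<alpha> a) b + br a (\<alpha> b)"
  and brP_const: "brP [:a:] [:b:] = [:br a b:]"
  and brP_x: "brP [:0, 1:] [:b:] = [:\<alpha> b:] * [:0, 1:] + [:\<delta> b:]"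
  using ore unfolding poisson_polynomial_algebra_def poisson_derivation_def algebra_derivation_def
  by blast+

lemma \<Delta>P_const: "\<Delta>P [:b:] = tmap (poly_scale s) (\<lambda>a. [:a:]) (\<lambda>a. [:a:]) (\<Delta> b)"
  and SP_const: "SP [:b:] = [:S b:]"
  using sub unfolding poisson_hopf_subalgebra_poly_def by blast+

section \<open>Comultiplication of constants, of x and of brackets with x\<close>

lemma tlift_const:
  assumes "bilin (poly_scale s) V F"
  shows "tlift V F (\<Delta>P [:b:]) = tlift V (\<lambda>a a'. F [:a:] [:a':]) (\<Delta> b)"
  by (simp add: \<Delta>P_const tlift_tmap[OF assms])

lemma tlift_x:
  assumes F: "bilin (poly_scale s) V F"
  shows "tlift V F (\<Delta>P [:0, 1:])
    = F [:g:] [:0, 1:] + F [:0, 1:] 1 + tlift V (\<lambda>u v. F [:u:] [:v:]) w"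
  by (simp add: comult_x tlift_tplus[OF F] tlift_pure2[OF F] tlift_tmap[OF F])

text \<open>The identity \<Delta>({x, b}) = {\<Delta>(x), \<Delta>(b)} tested on a bilinear map
  \<open>F\<close>: the left side expands \<Delta>(\<alpha>(b) x + \<delta>(b)), the right side the
  bracket of the three summands of \<Delta>(x) with \<Delta>(b).\<close>

lemma comult_bracket_x:
  assumes F: "bilin (poly_scale s) V F"
  shows "tlift V (\<lambda>a a'. F ([:a:] * [:g:]) ([:a':] * [:0, 1:]) + F ([:a:] * [:0, 1:]) ([:a':] * 1)
        + tlift V (\<lambda>u v. F ([:a:] * [:u:]) ([:a':] * [:v:])) w) (\<Delta> (\<alpha> b))
      + tlift V (\<lambda>a a'. F [:a:] [:a':]) (\<Delta> (\<delta> b))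
    = tlift V (\<lambda>b1 b2. F ([:g:] * [:b1:]) (brP [:0, 1:] [:b2:]) + F (brP [:g:] [:b1:]) ([:0, 1:] * [:b2:])) (\<Delta> b)
      + tlift V (\<lambda>b1 b2. F (brP [:0, 1:] [:b1:]) [:b2:]) (\<Delta> b)
      + tlift V (\<lambda>u v. tlift V (\<lambda>b1 b2. F ([:u:] * [:b1:]) (brP [:v:] [:b2:])
          + F (brP [:u:] [:b1:]) ([:v:] * [:b2:])) (\<Delta> b)) w"
    (is "?L = ?R")
proof -
  have zero: "F a 0 = 0" for a
    using bilin_zero(2)[OF F] .
  have *: "bilin (poly_scale s) V (\<lambda>a b. F (a * [:g:]) (b * [:0, 1:]) + F (a * [:0, 1:]) (b * 1)
      + tlift V (\<lambda>u v. F (a * [:u:]) (b * [:v:])) w)"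
    by (intro bilin_add bilin_tlift H.bilin_mult(2) F)
  have **: "bilin (poly_scale s) V (\<lambda>p q. tlift V (\<lambda>a a'. F (p * [:a:]) (brP q [:a':])
      + F (brP p [:a:]) (q * [:a':])) (\<Delta> b))"
    by (intro bilin_tlift H.bilin_bracket(2) F)
  have "?L = tlift V F (\<Delta>P ([:\<alpha> b:] * [:0, 1:] + [:\<delta> b:]))"
    by (simp only: H.comult_add H.comult_mult tlift_tplus[OF F] H.comult_in tmult_in_tensor_space
      tlift_tmult[OF F] tlift_const[OF *] tlift_x[OF H.bilin_mult(1)[OF F]] tlift_const[OF F])
  also have "\<dots> = tlift V F (tbracket (poly_scale s) brP (\<Delta>P [:0, 1:]) (\<Delta>P [:b:]))"
    by (simp only: H.comult_br brP_x[symmetric])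
  \<comment> \<open>Of the two terms that x \<otimes> 1 contributes, the one containing the bracket
    of 1 with a leg of \<Delta>(b) vanishes.\<close>
  also have "\<dots> = ?R"
    by (simp only: tlift_tbracket[OF F] tlift_x[OF **] tlift_const[OF H.bilin_bracket(1)[OF F]]
        H.br_one_left zero add_0_left mult_1_left)
  finally show ?thesis .
qed

text \<open>Coefficient of x \<otimes> 1: only the summand x \<otimes> 1 of \<Delta>(x) contributes,
  through the part \<alpha>(b) x of {x, b}.\<close>

lemma comult_\<alpha>:
  assumes f: "bilin s V f"
  shows "tlift V f (\<Delta> (\<alpha> b)) = tlift V (\<lambda>b1 b2. f (\<alpha> b1) b2) (\<Delta> b)"
  using comult_bracket_x[OF bilin_coeff[OF f, of 1 0], of b] bilin_vector_space(2)[OF f]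
  by (simp add: brP_const brP_x bilin_zero[OF f] tlift_zero mult.commute)

text \<open>Coefficient of 1 \<otimes> x: only g \<otimes> x contributes, and its bracket with
  \<Delta>(b) has two terms, one of them with {g, -}.\<close>

lemma comult_\<alpha>_g:
  assumes f: "bilin s V f"
  shows "tlift V (\<lambda>a a'. f (a * g) a') (\<Delta> (\<alpha> b))
    = tlift V (\<lambda>b1 b2. f (g * b1) (\<alpha> b2) + f (br g b1) b2) (\<Delta> b)"
  using comult_bracket_x[OF bilin_coeff[OF f, of 0 1], of b] bilin_vector_space(2)[OF f]
  by (simp add: brP_const brP_x bilin_zero[OF f] tlift_zero mult.commute)

text \<open>Constant coefficient: \<delta> enters through {x, b}, and every term with
  \<open>w\<close> survives.\<close>

lemma comult_\<delta>:
  assumes f: "bilin s V f"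
  shows "tlift V (\<lambda>a a'. tlift V (\<lambda>u v. f (a * u) (a' * v)) w) (\<Delta> (\<alpha> b)) + tlift V f (\<Delta> (\<delta> b))
    = tlift V (\<lambda>b1 b2. f (g * b1) (\<delta> b2)) (\<Delta> b) + tlift V (\<lambda>b1 b2. f (\<delta> b1) b2) (\<Delta> b)
      + tlift V (\<lambda>u v. tlift V (\<lambda>b1 b2. f (u * b1) (br v b2) + f (br u b1) (v * b2)) (\<Delta> b)) w"
  using comult_bracket_x[OF bilin_coeff[OF f, of 0 0], of b] bilin_vector_space(2)[OF f]
  by (simp add: brP_const brP_x bilin_zero[OF f] tlift_zero mult.commute)

section \<open>The two formulas for \<alpha> and the properties of \<eta>\<close>

lemma bilin_counit:
  shows "bilin s s (\<lambda>a b. s (\<epsilon> a) b)" and "bilin s s (\<lambda>a b. s (\<epsilon> b) a)"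
proof -
  interpret e: Vector_Spaces.linear s "(*)" \<epsilon> by (rule B.counit_linear)
  show "bilin s s (\<lambda>a b. s (\<epsilon> a) b)" "bilin s s (\<lambda>a b. s (\<epsilon> b) a)"
    by (intro bilinI B.vector_space_axioms;
        simp add: e.add e.scale B.scale_left_distrib B.scale_right_distrib mult.commute)+
qed

lemma scale_mult_right: "a * s c b = s c (a * b)"
  by (metis B.scale_mult_left mult.commute)

lemma \<alpha>_left: "\<alpha> b = tlift s (\<lambda>b1 b2. s (\<epsilon> (\<alpha> b1)) b2) (\<Delta> b)"
  using comult_\<alpha>[OF bilin_counit(1), of b] by (simp add: B.counit_left)

text \<open>Applying Id \<otimes> \<epsilon> to the coefficient of 1 \<otimes> x gives the formula
  multiplied by \<open>g\<close>, which is then cancelled.\<close>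

lemma \<alpha>_right: "\<alpha> b = tlift s (\<lambda>b1 b2. s (\<epsilon> (\<alpha> b2)) b1) (\<Delta> b) + br g b * unit_inverse g"
proof -
  have "\<alpha> b * g = tlift s (\<lambda>a a'. s (\<epsilon> a') a) (\<Delta> (\<alpha> b)) * g"
    by (simp add: B.counit_right)
  also have "\<dots> = tlift s (\<lambda>a a'. s (\<epsilon> a') (a * g)) (\<Delta> (\<alpha> b))"
    by (simp add: linear_of_tlift[OF B.linear_mult_left] B.scale_mult_left)
  also have "\<dots> = tlift s (\<lambda>b1 b2. s (\<epsilon> (\<alpha> b2)) (g * b1)) (\<Delta> b)
      + tlift s (\<lambda>b1 b2. s (\<epsilon> b2) (br g b1)) (\<Delta> b)"
    by (simp add: comult_\<alpha>_g[OF bilin_counit(2)] tlift_add[OF B.vector_space_axioms])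
  \<comment> \<open>The map {g, -} is linear, so it commutes with the contraction in the counit
    axiom.\<close>
  also have "tlift s (\<lambda>b1 b2. s (\<epsilon> b2) (br g b1)) (\<Delta> b) = br g b"
    using linear_of_tlift[OF B.br_linear_right[of g], of "\<lambda>b1 b2. s (\<epsilon> b2) b1" "\<Delta> b"]
      B.br_linear_right[of g]
    by (simp add: B.counit_right Vector_Spaces.linear_iff)
  also have "tlift s (\<lambda>b1 b2. s (\<epsilon> (\<alpha> b2)) (g * b1)) (\<Delta> b) = g * tlift s (\<lambda>b1 b2. s (\<epsilon> (\<alpha> b2)) b1) (\<Delta> b)"
    by (simp add: linear_of_tlift[OF B.linear_mult_right] scale_mult_right)
  finally have "\<alpha> b * g * unit_inverse g
    = (g * tlift s (\<lambda>b1 b2. s (\<epsilon> (\<alpha> b2)) b1) (\<Delta> b) + br g b) * unit_inverse g"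
    by simp
  moreover have "g * unit_inverse g = 1"
    by (rule B.group_like_unit[OF group_like])
  then have "a * g * unit_inverse g = a" "g * a * unit_inverse g = a" for a
    by (simp_all add: mult.assoc mult.left_commute[of g a])
  ultimately show ?thesis by (simp only: distrib_right)
qed

text \<open>With \<eta> = \<epsilon> \<circ> \<alpha>, the product rule comes from \<alpha> being a
  derivation and \<epsilon> multiplicative; brackets die because \<alpha> sends a bracket to a sum
  of brackets.\<close>

lemma counit_\<alpha>:
  shows "Vector_Spaces.linear s (*) (\<lambda>b. \<epsilon> (\<alpha> b))"
    and "\<epsilon> (\<alpha> (a * b)) = \<epsilon> a * \<epsilon> (\<alpha> b) + \<epsilon> b * \<epsilon> (\<alpha> a)"
    and "\<epsilon> (\<alpha> (br a b)) = 0"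
proof -
  interpret e: Vector_Spaces.linear s "(*)" \<epsilon> by (rule B.counit_linear)
  show "Vector_Spaces.linear s (*) (\<lambda>b. \<epsilon> (\<alpha> b))"
    using Vector_Spaces.linear_compose[OF linear_\<alpha> B.counit_linear] by (simp add: o_def)
  show "\<epsilon> (\<alpha> (a * b)) = \<epsilon> a * \<epsilon> (\<alpha> b) + \<epsilon> b * \<epsilon> (\<alpha> a)"
    by (simp add: \<alpha>_mult e.add B.counit_mult mult.commute add.commute)
  show "\<epsilon> (\<alpha> (br a b)) = 0"
    by (simp add: \<alpha>_br e.add B.counit_br)
qed

section \<open>The comultiplication of \<delta>(b)\<close>

lemma \<delta>_comult:
  "\<Delta> (\<delta> b) \<ominus> tmap s \<delta> (\<lambda>b2. b2) (\<Delta> b) \<ominus> tmap s (\<lambda>b1. g * b1) \<delta> (\<Delta> b)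
    = tbracket s br w (\<Delta> b) \<ominus> \<Delta> (\<alpha> b) \<odot>\<^bsub>s\<^esub> w"
proof (rule tensor2_eqI[OF B.vector_space_axioms])
  fix f :: "'b \<Rightarrow> 'b \<Rightarrow> 'k" assume f: "bilin s (*) f"
  show "tlift (*) f (\<Delta> (\<delta> b) \<ominus> tmap s \<delta> (\<lambda>b2. b2) (\<Delta> b) \<ominus> tmap s (\<lambda>b1. g * b1) \<delta> (\<Delta> b))
    = tlift (*) f (tbracket s br w (\<Delta> b) \<ominus> \<Delta> (\<alpha> b) \<odot>\<^bsub>s\<^esub> w)"
    using comult_\<delta>[OF f, of b]
    by (simp add: tlift_tminus[OF f] B.comult_in tlift_tmap[OF f] tlift_tmult[OF f]
        tlift_tbracket[OF f] algebra_simps)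
qed (simp_all add: B.comult_in)

section \<open>Constraints on \<open>w\<close> from the antipode and from coassociativity\<close>

lemma bilin_SP_mult:
  shows "bilin (poly_scale s) (poly_scale s) (\<lambda>p q. SP p * q)"
    and "bilin (poly_scale s) (poly_scale s) (\<lambda>p q. p * SP q)"
proof -
  show "bilin (poly_scale s) (poly_scale s) (\<lambda>p q. SP p * q)"
    "bilin (poly_scale s) (poly_scale s) (\<lambda>p q. p * SP q)"
    by (intro bilin_compose[OF H.bilin_times] H.antipode_linear H.linear_ident)+
qed

text \<open>As \<epsilon>(x) = 0, both antipode axioms at x have right side zero. Their constant
  coefficients express the two contractions of \<open>w\<close> through the same unknown, the
  constant coefficient \<open>?c\<close> of S(x), which is then eliminated.\<close>

lemma w_antipode:
  "tlift s (\<lambda>w1 w2. S w1 * w2) w = tlift s (\<lambda>w1 w2. unit_inverse g * w1 * S w2) w"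
proof -
  let ?c = "coeff (SP [:0, 1:]) 0"
  interpret SP: Vector_Spaces.linear "poly_scale s" "poly_scale s" SP by (rule H.antipode_linear)
  have "SP 1 = 1"
  proof -
    have "tlift (poly_scale s) (\<lambda>p q. SP p * q) (\<Delta>P 1) = SP 1"
      by (simp add: H.comult_one tlift_pure2[OF bilin_SP_mult(1)])
    then show ?thesis using H.antipode_left[of 1] by (simp add: H.counit_one)
  qed
  have "coeff (tlift (poly_scale s) (\<lambda>p q. SP p * q) (\<Delta>P [:0, 1:])) 0 = 0"
    by (simp add: H.antipode_left counit_x)
  \<comment> \<open>The summand g \<otimes> x gives S(g) x, with constant coefficient zero; x
    \<otimes> 1 gives \<open>?c\<close>.\<close>
  then have left: "?c + tlift s (\<lambda>u v. S u * v) w = 0"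
    by (simp add: tlift_x[OF bilin_SP_mult(1)] SP_const linear_of_tlift[OF linear_coeff],
        simp add: mult.commute)
  have "coeff (tlift (poly_scale s) (\<lambda>p q. p * SP q) (\<Delta>P [:0, 1:])) 0 = 0"
    by (simp add: H.antipode_right counit_x)
  \<comment> \<open>Now g \<otimes> x gives g times \<open>?c\<close>, while x \<otimes> 1 gives x
    S(1) = x, with constant coefficient zero.\<close>
  then have right: "g * ?c + tlift s (\<lambda>u v. u * S v) w = 0"
    by (simp add: tlift_x[OF bilin_SP_mult(2)] SP_const \<open>SP 1 = 1\<close> linear_of_tlift[OF linear_coeff],
        simp add: mult.commute)
  have "tlift s (\<lambda>w1 w2. unit_inverse g * w1 * S w2) w = unit_inverse g * tlift s (\<lambda>u v. u * S v) w"
    by (simp add: linear_of_tlift[OF B.linear_mult_right] mult.assoc)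
  also have "tlift s (\<lambda>u v. u * S v) w = g * - ?c"
    using right by (simp add: eq_neg_iff_add_eq_0 add.commute)
  also have "unit_inverse g * (g * - ?c) = (g * unit_inverse g) * - ?c"
    by (simp only: ac_simps)
  also have "\<dots> = tlift s (\<lambda>u v. S u * v) w"
    using left by (simp add: B.group_like_unit[OF group_like] neg_eq_iff_add_eq_0)
  finally show ?thesis ..
qed

text \<open>Taking constant coefficients in all three legs of coassociativity at x kills every term
  in which x itself remains as a leg. What is left of \<Delta>(x) \<otimes> 1 is w \<otimes> 1, and
  of g \<otimes> \<Delta>(x) it is g \<otimes> w.\<close>

lemma w_cocycle: "tensor_elt s w 1 \<oplus> comult_left s \<Delta> w = elt_tensor s g w \<oplus> comult_right s \<Delta> w"
proof (rule tensor3_eqI[OF B.vector_space_axioms])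
  show "tensor_elt s w 1 \<oplus> comult_left s \<Delta> w \<in> range (cls3 s)"
    "elt_tensor s g w \<oplus> comult_right s \<Delta> w \<in> range (cls3 s)"
    by (auto simp: tensor_elt_def elt_tensor_def comult_left_def comult_right_def tplus_cls3)
  fix f :: "'b \<Rightarrow> 'b \<Rightarrow> 'b \<Rightarrow> 'k" assume f: "trilin s (*) f"
  have zero: "f 0 a b = 0" "f a 0 b = 0" "f a b 0 = 0" for a b
    using f bilin_zero[of s "(*)" "\<lambda>a b. f a b c" for c] bilin_zero[of s "(*)" "f a" for a]
    by (simp_all add: trilin_def)
  define F where "F p q r = f (coeff p 0) (coeff q 0) (coeff r 0)" for p q r
  have F: "trilin (poly_scale s) (*) F"
    using f by (auto simp: trilin_def F_def[abs_def] intro: bilin_coeff)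
  then have FL: "bilin (poly_scale s) (*) (\<lambda>a b. F a b c)" and FR: "bilin (poly_scale s) (*) (F a)" for a c
    by (auto simp: trilin_def)
  \<comment> \<open>Linearity in the leg that is comultiplied comes from \<Delta>, in the other leg
    from \<open>F\<close>.\<close>
  have bL: "bilin (poly_scale s) (*) (\<lambda>p q. tlift (*) (\<lambda>p1 p2. F p1 p2 q) (\<Delta>P p))"
    using F unfolding bilin_def[of _ _ "\<lambda>p q. tlift _ _ _"]
    by (auto intro!: H.linear_tlift_comult linear_tlift_param simp: trilin_def bilin_def)
  have bR: "bilin (poly_scale s) (*) (\<lambda>p q. tlift (*) (F p) (\<Delta>P q))"
    using F unfolding bilin_def[of _ _ "\<lambda>p q. tlift _ _ _"]
    by (auto intro!: H.linear_tlift_comult linear_tlift_param simp: trilin_def bilin_def)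
  \<comment> \<open>The partially applied form occurs inside contractions when x is the first leg,
    hence an equation between functions.\<close>
  have Fx: "F [:0, 1:] = (\<lambda>_ _. 0)" by (simp add: F_def[abs_def] zero)
  have "tlift3 (*) F (comult_left (poly_scale s) \<Delta>P (\<Delta>P [:0, 1:]))
    = tlift (*) (\<lambda>u v. f u v 1) w + tlift (*) (\<lambda>u v. tlift (*) (\<lambda>u1 u2. f u1 u2 v) (\<Delta> u)) w"
    by (simp add: tlift3_comult_left[OF F] tlift_x[OF bL] tlift_x[OF FL] tlift_const[OF FL])
      (simp add: Fx, simp add: F_def zero tlift_zero[OF vector_space_mult])
  moreover have "tlift3 (*) F (comult_right (poly_scale s) \<Delta>P (\<Delta>P [:0, 1:]))
    = tlift (*) (f g) w + tlift (*) (\<lambda>u v. tlift (*) (f u) (\<Delta> v)) w"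
    by (simp add: tlift3_comult_right[OF F] tlift_x[OF bR] tlift_x[OF FR] tlift_const[OF FR])
      (simp add: Fx, simp add: F_def zero tlift_zero[OF vector_space_mult])
  moreover have "tensor_elt s w 1 \<in> range (cls3 s)" "elt_tensor s g w \<in> range (cls3 s)"
    "comult_left s \<Delta> w \<in> range (cls3 s)" "comult_right s \<Delta> w \<in> range (cls3 s)"
    by (auto simp: tensor_elt_def elt_tensor_def comult_left_def comult_right_def)
  ultimately show "tlift3 (*) f (tensor_elt s w 1 \<oplus> comult_left s \<Delta> w)
    = tlift3 (*) f (elt_tensor s g w \<oplus> comult_right s \<Delta> w)"
    by (simp add: tlift3_tplus[OF f] tlift3_tensor_elt[OF f] tlift3_elt_tensor[OF f]
        tlift3_comult_left[OF f] tlift3_comult_right[OF f] H.coassoc)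
qed

end

theorem theorem4p2:
  fixes s :: "'k::field \<Rightarrow> 'b::comm_ring_1 \<Rightarrow> 'b"
    and \<Delta> :: "'b \<Rightarrow> ('b, 'k) tensor2" and \<epsilon> :: "'b \<Rightarrow> 'k" and S :: "'b \<Rightarrow> 'b"
    and br :: "'b \<Rightarrow> 'b \<Rightarrow> 'b"
    and \<alpha> \<delta> :: "'b \<Rightarrow> 'b"
    and \<Delta>P :: "'b poly \<Rightarrow> ('b poly, 'k) tensor2" and \<epsilon>P :: "'b poly \<Rightarrow> 'k"
    and SP :: "'b poly \<Rightarrow> 'b poly" and brP :: "'b poly \<Rightarrow> 'b poly \<Rightarrow> 'b poly"
    and g :: 'b and w :: "('b, 'k) tensor2"
  assumes "poisson_hopf_algebra s \<Delta> \<epsilon> S br"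
    and "poisson_polynomial_algebra s br \<alpha> \<delta> brP"
    and "poisson_hopf_algebra (poly_scale s) \<Delta>P \<epsilon>P SP brP"
    and "poisson_hopf_subalgebra_poly s \<Delta> \<epsilon> S br \<Delta>P \<epsilon>P SP brP"
    and "\<epsilon>P [:0, 1:] = 0"
    and "group_like s \<Delta> \<epsilon> g"
    and "w \<in> augmentation_tensors s \<epsilon>"
    and "\<Delta>P [:0, 1:] =
      [:g:] \<otimes>\<^bsub>poly_scale s\<^esub> [:0, 1:] \<oplus> [:0, 1:] \<otimes>\<^bsub>poly_scale s\<^esub> 1
        \<oplus> tmap (poly_scale s) (\<lambda>a. [:a:]) (\<lambda>a. [:a:]) w"
  shows
    "(\<exists>\<eta> :: 'b \<Rightarrow> 'k. Vector_Spaces.linear s (*) \<eta> \<and>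
       (\<forall>b. \<alpha> b = tlift s (\<lambda>b1 b2. s (\<eta> b1) b2) (\<Delta> b)) \<and>
       (\<forall>b. \<alpha> b = tlift s (\<lambda>b1 b2. s (\<eta> b2) b1) (\<Delta> b) + br g b * unit_inverse g) \<and>
       (\<forall>a b. \<eta> (a * b) = \<epsilon> a * \<eta> b + \<epsilon> b * \<eta> a) \<and>
       (\<forall>a b. \<eta> (br a b) = 0)) \<and>
     (\<forall>b. \<Delta> (\<delta> b) \<ominus> tmap s \<delta> (\<lambda>b2. b2) (\<Delta> b) \<ominus> tmap s (\<lambda>b1. g * b1) \<delta> (\<Delta> b)
        = tbracket s br w (\<Delta> b) \<ominus> \<Delta> (\<alpha> b) \<odot>\<^bsub>s\<^esub> w) \<and>
     tlift s (\<lambda>w1 w2. S w1 * w2) w = tlift s (\<lambda>w1 w2. unit_inverse g * w1 * S w2) w \<and>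
     tensor_elt s w 1 \<oplus> comult_left s \<Delta> w = elt_tensor s g w \<oplus> comult_right s \<Delta> w"
proof -
  interpret poisson_hopf_ore_extension s \<Delta> \<epsilon> S br \<Delta>P \<epsilon>P SP brP \<alpha> \<delta> g w
    using assms unfolding poisson_hopf_ore_extension_def poisson_hopf_ore_extension_axioms_def
    by (auto simp: augmentation_tensors_def)
  show ?thesis
    by (intro conjI exI[of _ "\<lambda>b. \<epsilon> (\<alpha> b)"] allI)
      (rule counit_\<alpha> \<alpha>_left \<alpha>_right \<delta>_comult w_antipode w_cocycle)+
qed

end
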